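(* Let $\mathbb F$ be a field, $a\in\mathbb F$, and $d\ge2$ an integer. Consider $\operatorname{wm}_a$ as a function on graphs of maximum degree at most $d$. Then: (1) there is no $\mathbb F$-weighted graph $H$ with $|V(H)|<d$ such that $\operatorname{wm}_a(G)=\hom(G,H)$ for all simple graphs $G$ of maximum degree at most $d$; (2) if $\mathbb F$ is infinite, then there exists an $\mathbb F$-weighted graph $H$ with $|V(H)|=d$ such that $\operatorname{wm}_a(G)=\hom(G,H)$ for all graphs $G$ of maximum degree at most $d$, except in the case $a=0$, $d=2$, $\operatorname{char}\mathbb F=2$, in which case the minimal value of $|V(H)|$ for which such an $H$ exists is $3$.
   Context: Graphs are finite, may have multiple edges but no loops; degree counts edges with multiplicity. For a graph $G$, $\operatorname{wm}_a(G)=\sum_{M}a^{|V(G)|-2|M|}$, the sum over all matchings $M$ of $G$ (including the empty matching), with $a^0=1$ even if $a=0$. An $\mathbb F$-weighted graph $H$ is given by $q=|V(H)|\ge0$, vertex weights $\alpha_1,\dots,\alpha_q\in\mathbb F\setminus\{0\}$ and a symmetric matrix $B=(\beta_{ij})\in\mathbb F^{q\times q}$; $\hom(G,H)=\sum_{\phi:V(G)\to[q]}\prod_{u\in V(G)}\alpha_{\phi(u)}\prod_{uv\in E(G)}\beta_{\phi(u)\phi(v)}$ (edges with multiplicity; empty products equal $1$). *)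

theory Defs
  imports Complex_Main "HOL-Library.FuncSet" "HOL-Library.Disjoint_Sets"
    "HOL-Computational_Algebra.Computational_Algebra"
begin

text \<open>
  Parallel edges are distinct edge labels with the same set of ends. The empty graph is allowed.
\<close>

record ('v, 'e) mgraph =
  verts :: "'v set"
  edges :: "'e set"
  ends :: "'e \<Rightarrow> 'v set"

definition is_graph :: "('v, 'e) mgraph \<Rightarrow> bool" where
  "is_graph G \<longleftrightarrow> finite (verts G) \<and> finite (edges G) \<and>
     (\<forall>e\<in>edges G. ends G e \<subseteq> verts G \<and> card (ends G e) = 2)"

definition simple_graph :: "('v, 'e) mgraph \<Rightarrow> bool" where
  "simple_graph G \<longleftrightarrow> is_graph G \<and> inj_on (ends G) (edges G)"

definition degree :: "('v, 'e) mgraph \<Rightarrow> 'v \<Rightarrow> nat" where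
  "degree G v = card {e \<in> edges G. v \<in> ends G e}"

definition max_degree_le :: "('v, 'e) mgraph \<Rightarrow> nat \<Rightarrow> bool" where
  "max_degree_le G d \<longleftrightarrow> (\<forall>v\<in>verts G. degree G v \<le> d)"

definition matchings :: "('v, 'e) mgraph \<Rightarrow> 'e set set" where
  "matchings G = {M. M \<subseteq> edges G \<and> disjoint_family_on (ends G) M}"

text \<open>
  The natural number subtraction does not truncate, since a matching \<open>M\<close> covers
  \<open>2 * card M\<close> vertices.
\<close>

definition wm :: "'a::field \<Rightarrow> ('v, 'e) mgraph \<Rightarrow> 'a" where
  "wm a G = (\<Sum>M\<in>matchings G. a ^ (card (verts G) - 2 * card M))"

text \<open>The vertices of a weighted graph \<open>H\<close> are the natural numbers below \<open>wsize H\<close>.\<close>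

record 'a wgraph =
  wsize :: nat
  vweight :: "nat \<Rightarrow> 'a"
  eweight :: "nat \<Rightarrow> nat \<Rightarrow> 'a"

definition is_wgraph :: "'a::field wgraph \<Rightarrow> bool" where
  "is_wgraph H \<longleftrightarrow> (\<forall>i<wsize H. vweight H i \<noteq> 0) \<and>
     (\<forall>i<wsize H. \<forall>j<wsize H. eweight H i j = eweight H j i)"

text \<open>
  The factor contributed by the edge \<open>e = uv\<close> to the homomorphism sum; it does not depend on the
  order in which the two ends are listed because the edge weights are symmetric.
\<close>

definition edge_factor ::
    "('v, 'e) mgraph \<Rightarrow> 'a wgraph \<Rightarrow> ('v \<Rightarrow> nat) \<Rightarrow> 'e \<Rightarrow> 'a" where
  "edge_factor G H \<phi> e = (THE b. \<exists>u v. ends G e = {u, v} \<and> b = eweight H (\<phi> u) (\<phi> v))"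

lemma edge_factor_eq:
  assumes "is_graph G" "is_wgraph H" "\<phi> \<in> verts G \<rightarrow> {..<wsize H}"
    and "e \<in> edges G" "ends G e = {u, v}"
  shows "edge_factor G H \<phi> e = eweight H (\<phi> u) (\<phi> v)"
proof -
  have "u \<in> verts G" "v \<in> verts G"
    using assms unfolding is_graph_def by auto
  hence "\<phi> u < wsize H" "\<phi> v < wsize H"
    using assms(3) by auto
  hence sym: "eweight H (\<phi> u) (\<phi> v) = eweight H (\<phi> v) (\<phi> u)"
    using assms(2) unfolding is_wgraph_def by auto
  show ?thesis
    unfolding edge_factor_def using assms(5) sym
    by (intro the_equality) (auto simp: doubleton_eq_iff)
qed

definition hom_number :: "('v, 'e) mgraph \<Rightarrow> 'a::field wgraph \<Rightarrow> 'a" where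
  "hom_number G H = (\<Sum>\<phi>\<in>verts G \<rightarrow>\<^sub>E {..<wsize H}.
     (\<Prod>u\<in>verts G. vweight H (\<phi> u)) * (\<Prod>e\<in>edges G. edge_factor G H \<phi> e))"

text \<open>
  Every finite graph is isomorphic to one whose vertices and edge labels are natural numbers, so
  a quantifier over such graphs ranges over all graphs up to isomorphism.
\<close>

type_synonym graph = "(nat, nat) mgraph"

end

theory Submission imports Defs begin

text \<open>
  Let \<open>L\<close> be the functional on polynomials with \<open>L p = a * p(0) + p'(0)\<close>, so that its moments
  \<open>L (x^k)\<close> are \<open>a, 1, 0, 0, \<dots>\<close>. The matching sum is the sum over all edge sets \<open>M\<close> of the product
  over the vertices \<open>v\<close> of the \<open>deg\<^sub>M v\<close>-th moment. If the nodes \<open>t\<^sub>i\<close> with weights \<open>\<alpha>\<^sub>i\<close> have the same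
  moments up to order \<open>d\<close>, expanding the product over the edges shows that the vertex weights \<open>\<alpha>\<^sub>i\<close>
  and the edge weights \<open>1 + t\<^sub>i t\<^sub>j\<close> solve the problem. For \<open>d\<close> nodes with nonzero weights this is
  possible iff there are \<open>d\<close> distinct nonzero \<open>u\<^sub>i = 1 / t\<^sub>i\<close> with sum \<open>a\<close>; then \<open>\<alpha>\<^sub>i = u\<^sub>i^d / (\<Prod>j\<noteq>i. u\<^sub>i - u\<^sub>j)\<close>.

  For the lower bound, consider spiders with \<open>d\<close> legs of length one or two. Since the two kinds of
  legs span the linear polynomials, any \<open>H\<close> with \<open>q\<close> vertices gives points \<open>(s\<^sub>i, t\<^sub>i)\<close> in the plane with
  \<open>(\<Sum>i<q. \<alpha>\<^sub>i * P(s\<^sub>i, t\<^sub>i)) = L (P(1, x))\<close> for every product \<open>P\<close> of \<open>d\<close> linear forms. If \<open>q < d\<close>, a product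
  of \<open>d - 1\<close> linear forms vanishes at all points, and it can be chosen not to be divisible by the square
  of the second coordinate. Adding either coordinate as the last factor makes \<open>L\<close> vanish
  and forces divisibility by that square, a contradiction.

  In the exceptional case the solution for \<open>d = 3\<close> has three vertices, and two vertices are excluded by
  two vertices joined by zero, one or two parallel edges.
\<close>

section \<open>Moments, and the expansion over edge sets\<close>

definition moment :: "'a::field \<Rightarrow> nat \<Rightarrow> 'a" where
  "moment a k = (if k = 0 then a else if k = 1 then 1 else 0)"

text \<open>Two edges of \<open>M\<close> that share a vertex give it degree at least 2, where the
  moment is 0, so only matchings survive. A matching contributes 1 at each vertex it covers and
  \<open>a\<close> at each other vertex.\<close>

lemma wm_eq_sum_moments:
  fixes G :: "('v, 'e) mgraph"
  assumes "is_graph G"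
  shows "wm a G = (\<Sum>M\<in>Pow (edges G). \<Prod>v\<in>verts G. moment a (card {e \<in> M. v \<in> ends G e}))"
proof -
  have fin: "finite (verts G)" "finite (edges G)"
    and ends: "\<And>e. e \<in> edges G \<Longrightarrow> ends G e \<subseteq> verts G \<and> card (ends G e) = 2"
    using assms by (auto simp: is_graph_def)
  have "(\<Prod>v\<in>verts G. moment a (card {e \<in> M. v \<in> ends G e})) = 0"
    if M: "M \<in> Pow (edges G) - matchings G" for M
  proof -
    obtain e f v where ef: "e \<in> M" "f \<in> M" "e \<noteq> f" "v \<in> ends G e" "v \<in> ends G f"
      using M by (auto simp: matchings_def disjoint_family_on_def)
    have finM: "finite M" using M fin finite_subset by auto
    have "card {e, f} \<le> card {e \<in> M. v \<in> ends G e}"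
      using finM ef by (intro card_mono) auto
    hence "moment a (card {e \<in> M. v \<in> ends G e}) = 0"
      using ef by (auto simp: moment_def)
    moreover have "v \<in> verts G" using ef M ends by blast
    ultimately show ?thesis using fin by (meson prod_zero)
  qed
  moreover have "(\<Prod>v\<in>verts G. moment a (card {e \<in> M. v \<in> ends G e}))
      = a ^ (card (verts G) - 2 * card M)" if M: "M \<in> matchings G" for M
  proof -
    define U where "U = (\<Union>e\<in>M. ends G e)"
    have ME: "M \<subseteq> edges G" and disj: "disjoint_family_on (ends G) M"
      using M by (auto simp: matchings_def)
    have finM: "finite M" using ME fin finite_subset by auto
    have UV: "U \<subseteq> verts G" unfolding U_def using ME ends by blast
    have "card U = (\<Sum>e\<in>M. card (ends G e))"
      unfolding U_def using finM ends ME fin disj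
      by (intro card_UN_disjoint) (auto simp: disjoint_family_on_def intro: finite_subset)
    also have "\<dots> = 2 * card M" using ends ME by (simp add: subset_iff)
    finally have cU: "card U = 2 * card M" .
    have mom: "moment a (card {e \<in> M. v \<in> ends G e}) = (if v \<in> U then 1 else a)" for v
    proof (cases "v \<in> U")
      case True
      then obtain e where "e \<in> M" "v \<in> ends G e" unfolding U_def by auto
      hence "{e \<in> M. v \<in> ends G e} = {e}"
        using disj by (auto simp: disjoint_family_on_def)
      thus ?thesis using True by (simp add: moment_def)
    next
      case False
      hence "{e \<in> M. v \<in> ends G e} = {}" unfolding U_def by auto
      thus ?thesis using False by (simp only: moment_def) simp
    qed
    have "(\<Prod>v\<in>verts G. if v \<in> U then 1 else a) = (\<Prod>v\<in>verts G - U. a)"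
      using fin UV by (intro prod.mono_neutral_cong_right) auto
    also have "\<dots> = a ^ (card (verts G) - 2 * card M)"
      using UV fin cU by (simp add: card_Diff_subset finite_subset)
    finally show ?thesis by (simp add: mom)
  qed
  moreover have "matchings G \<subseteq> Pow (edges G)" by (auto simp: matchings_def)
  ultimately show ?thesis
    unfolding wm_def using fin by (intro sum.mono_neutral_cong_left) auto
qed

text \<open>Expanding the product of the factors \<open>1 + x i * x j\<close> selects a set
  \<open>M\<close> of edges. Once \<open>M\<close> is fixed, no factor couples the images of two
  vertices, so the sum over \<phi> splits into a product over the vertices.\<close>

lemma hom_number_rank_two:
  fixes G :: "('v, 'e) mgraph" and x :: "nat \<Rightarrow> 'a::field"
  assumes G: "is_graph G" and H: "is_wgraph H"
    and rank: "\<And>i j. eweight H i j = 1 + x i * x j"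
  shows "hom_number G H = (\<Sum>M\<in>Pow (edges G). \<Prod>v\<in>verts G.
      \<Sum>i<wsize H. vweight H i * x i ^ card {e \<in> M. v \<in> ends G e})"
proof -
  have fin: "finite (verts G)" "finite (edges G)"
    and ends: "\<And>e. e \<in> edges G \<Longrightarrow> ends G e \<subseteq> verts G \<and> card (ends G e) = 2"
    using G by (auto simp: is_graph_def)
  have edges_prod: "(\<Prod>e\<in>edges G. edge_factor G H \<phi> e)
      = (\<Sum>M\<in>Pow (edges G). \<Prod>v\<in>verts G. x (\<phi> v) ^ card {e \<in> M. v \<in> ends G e})"
    if \<phi>: "\<phi> \<in> verts G \<rightarrow>\<^sub>E {..<wsize H}" for \<phi>
  proof -
    have "edge_factor G H \<phi> e = (\<Prod>v\<in>ends G e. x (\<phi> v)) + 1" if e: "e \<in> edges G" for e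
    proof -
      obtain u v where uv: "ends G e = {u, v}" "u \<noteq> v"
        using ends[OF e] by (auto simp: card_2_iff)
      show ?thesis
        using edge_factor_eq[OF G H _ e uv(1), of \<phi>] \<phi> uv rank by (auto simp: PiE_iff add.commute)
    qed
    hence "(\<Prod>e\<in>edges G. edge_factor G H \<phi> e) = (\<Prod>e\<in>edges G. (\<Prod>v\<in>ends G e. x (\<phi> v)) + 1)"
      by simp
    also have "\<dots> = (\<Sum>M\<in>Pow (edges G). \<Prod>e\<in>M. \<Prod>v\<in>ends G e. x (\<phi> v))"
      using fin by (simp add: prod_add)
    also have "\<dots> = (\<Sum>M\<in>Pow (edges G). \<Prod>v\<in>verts G. x (\<phi> v) ^ card {e \<in> M. v \<in> ends G e})"
    proof (rule sum.cong[OF refl])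
      fix M assume M: "M \<in> Pow (edges G)"
      have finM: "finite M" using M fin finite_subset by auto
      have "(\<Prod>e\<in>M. \<Prod>v\<in>ends G e. x (\<phi> v))
          = (\<Prod>e\<in>M. \<Prod>v\<in>verts G. if v \<in> ends G e then x (\<phi> v) else 1)"
        using M ends fin by (intro prod.cong[OF refl] prod.mono_neutral_cong_left) auto
      also have "\<dots> = (\<Prod>v\<in>verts G. \<Prod>e\<in>M. if v \<in> ends G e then x (\<phi> v) else 1)"
        by (rule prod.swap)
      also have "\<dots> = (\<Prod>v\<in>verts G. x (\<phi> v) ^ card {e \<in> M. v \<in> ends G e})"
        using finM by (intro prod.cong[OF refl])
          (simp add: prod.inter_filter[symmetric])
      finally show "(\<Prod>e\<in>M. \<Prod>v\<in>ends G e. x (\<phi> v))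
          = (\<Prod>v\<in>verts G. x (\<phi> v) ^ card {e \<in> M. v \<in> ends G e})" .
    qed
    finally show ?thesis .
  qed
  have "hom_number G H = (\<Sum>\<phi>\<in>verts G \<rightarrow>\<^sub>E {..<wsize H}. \<Sum>M\<in>Pow (edges G).
      \<Prod>v\<in>verts G. vweight H (\<phi> v) * x (\<phi> v) ^ card {e \<in> M. v \<in> ends G e})"
    unfolding hom_number_def
    by (rule sum.cong[OF refl]) (simp add: edges_prod sum_distrib_left prod.distrib)
  also have "\<dots> = (\<Sum>M\<in>Pow (edges G). \<Prod>v\<in>verts G.
      \<Sum>i<wsize H. vweight H i * x i ^ card {e \<in> M. v \<in> ends G e})"
    using fin by (subst sum.swap) (simp add: prod_sum_PiE)
  finally show ?thesis .
qed

section \<open>Lagrange interpolation and the moment problem\<close>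

text \<open>The left side is the top coefficient of the Lagrange interpolant \<open>r\<close> of
  \<open>p\<close> on \<open>U\<close> (a divided difference), and \<open>p\<close> has small enough
  degree to equal its interpolant.\<close>

lemma sum_poly_div_diffs:
  fixes p :: "'a::field poly"
  assumes U: "finite U" "U \<noteq> {}" and deg: "Polynomial.degree p < card U"
  shows "(\<Sum>u\<in>U. poly p u / (\<Prod>v\<in>U - {u}. u - v)) = coeff p (card U - 1)"
proof -
  \<comment> \<open>An unnormalised Lagrange basis: \<open>b u\<close> is monic and vanishes on
    \<open>U\<close> exactly away from \<open>u\<close>.\<close>
  define b where "b u = (\<Prod>v\<in>U - {u}. [:-v, 1:])" for u
  define r where "r = (\<Sum>u\<in>U. smult (poly p u / (\<Prod>v\<in>U - {u}. u - v)) (b u))"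
  have degb: "Polynomial.degree (b u) = card U - 1" if "u \<in> U" for u
    unfolding b_def using that U
    by (subst degree_prod_eq_sum_degree) auto
  have "lead_coeff (b u) = 1" for u
    unfolding b_def by (simp add: lead_coeff_prod)
  hence cb: "coeff (b u) (card U - 1) = 1" if "u \<in> U" for u
    using degb that by metis
  have "poly r w = poly p w" if w: "w \<in> U" for w
  proof -
    have "poly r w = (\<Sum>u\<in>U. if u = w then poly p w else 0)"
      unfolding r_def poly_sum
    proof (rule sum.cong[OF refl])
      fix u assume u: "u \<in> U"
      show "poly (smult (poly p u / (\<Prod>v\<in>U - {u}. u - v)) (b u)) w = (if u = w then poly p w else 0)"
      proof (cases "u = w")
        case True
        have "(\<Prod>v\<in>U - {w}. w - v) \<noteq> 0" using U by (auto simp: prod_zero_iff)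
        thus ?thesis using True by (simp add: b_def poly_prod)
      next
        case False
        hence "poly (b u) w = 0" using w U by (auto simp: b_def poly_prod intro!: prod_zero)
        thus ?thesis using False by simp
      qed
    qed
    thus ?thesis using w U by simp
  qed
  moreover have "Polynomial.degree r \<le> card U - 1"
    unfolding r_def using U degb by (intro degree_sum_le) (auto intro: order_trans[OF degree_smult_le])
  ultimately have "r = p"
    using deg U by (intro poly_eqI_degree[of U]) auto
  hence "coeff p (card U - 1) = coeff r (card U - 1)" by simp
  also have "\<dots> = (\<Sum>u\<in>U. poly p u / (\<Prod>v\<in>U - {u}. u - v))"
    unfolding r_def using cb by (simp add: coeff_sum)
  finally show ?thesis by simp
qed

text \<open>Vieta: multiplying a monic polynomial by the factor with root \<open>x\<close> lowers
  the coefficient below the leading one by \<open>x\<close>.\<close>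

lemma coeff_prod_linear_factors:
  fixes U :: "'a::idom set"
  assumes "finite U" "U \<noteq> {}"
  shows "coeff (\<Prod>u\<in>U. [:-u, 1:]) (card U - 1) = - \<Sum>U"
  using assms
proof (induction U rule: finite_ne_induct)
  case (insert x U)
  have "Polynomial.degree (\<Prod>u\<in>U. [:-u, 1:]) = card U"
    by (subst degree_prod_eq_sum_degree) auto
  moreover have "lead_coeff (\<Prod>u\<in>U. [:-u, 1:]) = 1" by (simp add: lead_coeff_prod)
  ultimately have "coeff (\<Prod>u\<in>U. [:-u, 1:]) (card U) = 1" by metis
  moreover obtain n where "card U = Suc n"
    using insert.hyps by (metis card_gt_0_iff gr0_implies_Suc)
  ultimately show ?case using insert by simp
qed simp

text \<open>This solves the moment problem with nodes \<open>inverse u\<close>: cancelling powers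
  turns the sum into a divided difference of \<open>u ^ (card U - k)\<close>, which picks out a
  single coefficient when \<open>k > 0\<close>.\<close>

lemma sum_powers_div_diffs:
  fixes U :: "'a::field set"
  assumes U: "finite U" "U \<noteq> {}" "0 \<notin> U" and k: "k \<le> card U"
  shows "(\<Sum>u\<in>U. u ^ card U / (\<Prod>v\<in>U - {u}. u - v) * inverse u ^ k) = moment (\<Sum>U) k"
proof -
  define n where "n = card U"
  have n: "n > 0" using U by (auto simp: n_def card_gt_0_iff)
  have eq: "(\<Sum>u\<in>U. u ^ card U / (\<Prod>v\<in>U - {u}. u - v) * inverse u ^ k)
      = (\<Sum>u\<in>U. u ^ (n - k) / (\<Prod>v\<in>U - {u}. u - v))"
  proof (rule sum.cong[OF refl])
    fix u assume "u \<in> U"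
    hence "u \<noteq> 0" using U by auto
    hence "u ^ n * inverse u ^ k = u ^ (n - k)"
      using k by (simp add: n_def power_diff power_inverse divide_inverse)
    thus "u ^ card U / (\<Prod>v\<in>U - {u}. u - v) * inverse u ^ k = u ^ (n - k) / (\<Prod>v\<in>U - {u}. u - v)"
      by (simp add: n_def field_simps)
  qed
  show ?thesis
  proof (cases "k = 0")
    case True
    \<comment> \<open>For \<open>k = 0\<close> the monomial has degree \<open>n\<close>, too large
      for interpolation on \<open>n\<close> points. Subtracting the monic \<open>f\<close>, which
      vanishes on \<open>U\<close>, keeps its values there and leaves \<Sum>\<open>U\<close> as
      coefficient of order \<open>n - 1\<close>.\<close>
    define f where "f = (\<Prod>u\<in>U. [:-u, 1:])"
    have "Polynomial.degree f = n" unfolding f_def n_def by (subst degree_prod_eq_sum_degree) auto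
    moreover have "lead_coeff f = 1" by (simp add: f_def lead_coeff_prod)
    ultimately have "Polynomial.degree (monom 1 n - f) \<le> n" "coeff (monom 1 n - f) n = 0"
      by (auto intro: degree_diff_le simp: degree_monom_eq)
    hence "Polynomial.degree (monom 1 n - f) < n"
      using n eq_zero_or_degree_less by fastforce
    hence "(\<Sum>u\<in>U. poly (monom 1 n - f) u / (\<Prod>v\<in>U - {u}. u - v)) = coeff (monom 1 n - f) (n - 1)"
      unfolding n_def using U by (intro sum_poly_div_diffs) auto
    moreover have "poly (monom 1 n - f) u = u ^ n" if "u \<in> U" for u
      using that U by (auto simp: f_def poly_prod poly_monom intro!: prod_zero)
    moreover have "coeff (monom 1 n - f) (n - 1) = \<Sum>U"
      using coeff_prod_linear_factors[OF U(1,2)] n by (simp add: f_def n_def)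
    ultimately show ?thesis using True eq by (simp add: moment_def)
  next
    case False
    have "(\<Sum>u\<in>U. poly (monom 1 (n - k)) u / (\<Prod>v\<in>U - {u}. u - v)) = coeff (monom 1 (n - k)) (n - 1)"
      unfolding n_def using U False n
      by (intro sum_poly_div_diffs) (auto simp: degree_monom_eq n_def)
    moreover have "n - k = n - 1 \<longleftrightarrow> k = 1"
      using False k n by (auto simp: n_def)
    ultimately show ?thesis using False eq by (simp add: poly_monom moment_def)
  qed
qed

section \<open>Choice of the nodes and the upper bound\<close>

text \<open>Fix \<open>d - 2\<close> elements \<open>S\<close>, then add a generic \<open>u\<close>
  and \<open>c - u\<close>, where \<open>c\<close> is the sum still missing. These two can be forced
  to coincide only if \<open>c = 0\<close> in characteristic 2, which the choice of \<open>S\<close>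
  avoids; for \<open>d = 2\<close>, where \<open>S\<close> is empty, this is the excluded
  case.\<close>

lemma ex_nonzero_set_with_sum:
  fixes a :: "'a::field"
  assumes inf: "infinite (UNIV :: 'a set)" and "d \<ge> 2"
    and exc: "\<not> (a = 0 \<and> d = 2 \<and> CHAR('a) = 2)"
  obtains U :: "'a set" where "finite U" "card U = d" "0 \<notin> U" "\<Sum>U = a"
proof -
  have fresh: "\<exists>x. x \<notin> S" if "finite S" for S :: "'a set"
    using inf that ex_new_if_finite by blast
  have nz: "\<exists>S. finite S \<and> card S = n \<and> S \<subseteq> UNIV - {0::'a}" for n
    using infinite_arbitrarily_large[of "UNIV - {0::'a}" n] inf by auto
  have "\<exists>S. finite S \<and> card S = d - 2 \<and> 0 \<notin> S \<and> (\<Sum>S \<noteq> a \<or> CHAR('a) \<noteq> 2)"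
  proof (cases "d = 2")
    case True
    thus ?thesis using exc by (intro exI[of _ "{}"]) auto
  next
    case False
    obtain S :: "'a set" where S: "finite S" "card S = d - 3" "0 \<notin> S" using nz[of "d - 3"] by auto
    \<comment> \<open>Excluding \<open>a - \<Sum>S\<close> makes the sum of
      \<open>insert w S\<close> differ from \<open>a\<close>.\<close>
    obtain w where "w \<notin> S \<union> {0, a - \<Sum>S}" using fresh[of "S \<union> {0, a - \<Sum>S}"] S by auto
    thus ?thesis using S False \<open>d \<ge> 2\<close>
      by (intro exI[of _ "insert w S"]) (auto simp: algebra_simps)
  qed
  then obtain S :: "'a set" where S: "finite S" "card S = d - 2" "0 \<notin> S"
    and ne: "\<Sum>S \<noteq> a \<or> CHAR('a) \<noteq> 2" by blast
  define c where "c = a - \<Sum>S"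
  \<comment> \<open>Excluding 0 and \<open>c\<close> keeps both new elements nonzero, and excluding
    \<open>S\<close> and its reflection keeps them outside \<open>S\<close>. Excluding
    \<open>c / 2\<close> separates them if 2 is invertible; otherwise \<open>c / 2\<close> is 0 by
    convention.\<close>
  obtain u where u: "u \<notin> S \<union> {0, c, c / 2} \<union> (\<lambda>s. c - s) ` S"
    using fresh[of "S \<union> {0, c, c / 2} \<union> (\<lambda>s. c - s) ` S"] S by auto
  have "u \<noteq> c - u"
  proof
    assume "u = c - u"
    hence c: "c = 2 * u" by (simp add: algebra_simps)
    have "(2::'a) = 0" using c u by auto
    hence "CHAR('a) dvd 2" using of_nat_eq_0_iff_char_dvd[of 2, where ?'a = 'a] by simp
    hence "CHAR('a) = 1 \<or> CHAR('a) = 2" using prime_nat_iff two_is_prime_nat by blast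
    moreover have "CHAR('a) \<noteq> 1" using of_nat_eq_0_iff_char_dvd[of 1, where ?'a = 'a] by auto
    ultimately have "CHAR('a) = 2" by simp
    with ne c \<open>2 = 0\<close> show False by (simp add: c_def)
  qed
  moreover have "c - u \<notin> S" using u by (auto simp: image_iff algebra_simps)
  ultimately have "card (insert u (insert (c - u) S)) = d" "0 \<notin> insert u (insert (c - u) S)"
      "\<Sum>(insert u (insert (c - u) S)) = a"
    using u S \<open>d \<ge> 2\<close> by (auto simp: c_def)
  thus ?thesis using that[of "insert u (insert (c - u) S)"] S by auto
qed

text \<open>Vertex degrees in an edge set \<open>M\<close> of \<open>G\<close> are at most
  \<open>d\<close>, so the two expansions over edge sets compare only moments of order up to
  \<open>d\<close>, where they agree.\<close>

lemma ex_wgraph: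
  fixes a :: "'a::field"
  assumes inf: "infinite (UNIV :: 'a set)" and d: "d \<ge> 2"
    and exc: "\<not> (a = 0 \<and> d = 2 \<and> CHAR('a) = 2)"
  obtains H :: "'a wgraph" where "is_wgraph H" "wsize H = d"
    "\<And>G :: ('v, 'e) mgraph. is_graph G \<Longrightarrow> max_degree_le G d \<Longrightarrow> wm a G = hom_number G H"
proof -
  obtain U :: "'a set" where U: "finite U" "card U = d" "0 \<notin> U" "\<Sum>U = a"
    using ex_nonzero_set_with_sum[OF assms] .
  obtain u where u: "bij_betw u {..<d} U"
    using ex_bij_betw_nat_finite[OF U(1)] U(2) by (auto simp: atLeast0LessThan)
  define w where "w x = x ^ d / (\<Prod>v\<in>U - {x}. x - v)" for x
  define H where "H = \<lparr>wsize = d, vweight = (\<lambda>i. w (u i)),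
      eweight = (\<lambda>i j. 1 + inverse (u i) * inverse (u j))\<rparr>"
  have w0: "w x \<noteq> 0" if "x \<in> U" for x
    using that U by (auto simp: w_def)
  have H: "is_wgraph H"
    using u w0 by (auto simp: is_wgraph_def H_def mult.commute bij_betw_def)
  have "U \<noteq> {}" using U d by auto
  hence mom: "(\<Sum>i<d. w (u i) * inverse (u i) ^ k) = moment a k" if "k \<le> d" for k
    using sum_powers_div_diffs[of U k] U that d sum.reindex_bij_betw[OF u, of "\<lambda>x. w x * inverse x ^ k"]
    by (auto simp: w_def)
  have "wm a G = hom_number G H" if G: "is_graph G" "max_degree_le G d" for G :: "('v, 'e) mgraph"
  proof -
    have "hom_number G H = (\<Sum>M\<in>Pow (edges G). \<Prod>v\<in>verts G.
      \<Sum>i<wsize H. vweight H i * inverse (u i) ^ card {e \<in> M. v \<in> ends G e})"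
      by (rule hom_number_rank_two[OF G(1) H]) (simp add: H_def)
    also have "\<dots> = (\<Sum>M\<in>Pow (edges G). \<Prod>v\<in>verts G. moment a (card {e \<in> M. v \<in> ends G e}))"
    proof (intro sum.cong prod.cong refl)
      fix M v assume M: "M \<in> Pow (edges G)" and v: "v \<in> verts G"
      have "card {e \<in> M. v \<in> ends G e} \<le> degree G v"
        unfolding degree_def using G M by (intro card_mono) (auto simp: is_graph_def)
      also have "\<dots> \<le> d" using G v by (simp add: max_degree_le_def)
      finally show "(\<Sum>i<wsize H. vweight H i * inverse (u i) ^ card {e \<in> M. v \<in> ends G e})
          = moment a (card {e \<in> M. v \<in> ends G e})"
        using mom by (simp add: H_def)
    qed
    finally show ?thesis using wm_eq_sum_moments[OF G(1)] by simp
  qed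
  thus ?thesis using that[of H] H by (simp add: H_def)
qed

section \<open>The moment functional, and trees with their leaves removed\<close>

definition moment_functional :: "'a::field \<Rightarrow> 'a poly \<Rightarrow> 'a" where
  "moment_functional a p = a * coeff p 0 + coeff p 1"

lemma moment_functional_simps:
  "moment_functional a (p + q) = moment_functional a p + moment_functional a q"
  "moment_functional a (smult c p) = c * moment_functional a p"
  "moment_functional a (monom 1 k) = moment a k"
  by (auto simp: moment_functional_def moment_def algebra_simps)

text \<open>The edge from a vertex to its parent is labelled by the child. With
  \<open>p v < v\<close>, vertex 0 is the root and \<open>n\<close> is a leaf, so trees can be
  dismantled by decreasing \<open>n\<close>.\<close>

definition tree :: "(nat \<Rightarrow> nat) \<Rightarrow> nat \<Rightarrow> graph" where
  "tree p n = \<lparr>verts = {..n}, edges = {1..n}, ends = (\<lambda>e. {e, p e})\<rparr>"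

lemma simple_tree:
  assumes p: "\<And>v. 0 < v \<Longrightarrow> p v < v"
  shows "simple_graph (tree p n)"
proof -
  have "{e, p e} \<subseteq> {..n} \<and> card {e, p e} = 2" if "e \<in> {1..n}" for e
    using p[of e] that by (auto simp: card_2_iff)
  moreover have "inj_on (\<lambda>e. {e, p e}) {1..n}"
  proof (rule inj_onI)
    fix e f assume ef: "e \<in> {1..n}" "f \<in> {1..n}" "{e, p e} = {f, p f}"
    thus "e = f" using p[of e] p[of f] by (auto simp: doubleton_eq_iff)
  qed
  ultimately show ?thesis by (auto simp: simple_graph_def is_graph_def tree_def)
qed

text \<open>
  The vertex-dependent weights \<open>c\<close> here and in \<open>matching_sum\<close> allow a leaf to be removed by modifying the
  weight of its neighbour.
\<close>

definition hom_sum :: "'a::field wgraph \<Rightarrow> (nat \<Rightarrow> nat) \<Rightarrow> nat \<Rightarrow> (nat \<Rightarrow> nat \<Rightarrow> 'a) \<Rightarrow> 'a" where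
  "hom_sum H p n c = (\<Sum>\<phi>\<in>{..n} \<rightarrow>\<^sub>E {..<wsize H}.
     (\<Prod>v\<le>n. c v (\<phi> v)) * (\<Prod>e\<in>{1..n}. eweight H (\<phi> (p e)) (\<phi> e)))"

lemma hom_number_tree:
  fixes H :: "'a::field wgraph"
  assumes p: "\<And>v. 0 < v \<Longrightarrow> p v < v" and H: "is_wgraph H"
  shows "hom_number (tree p n) H = hom_sum H p n (\<lambda>_. vweight H)"
proof -
  have G: "is_graph (tree p n)" using simple_tree[OF p] by (simp add: simple_graph_def)
  have "edge_factor (tree p n) H \<phi> e = eweight H (\<phi> (p e)) (\<phi> e)"
    if "\<phi> \<in> {..n} \<rightarrow>\<^sub>E {..<wsize H}" "e \<in> {1..n}" for \<phi> e
    using edge_factor_eq[OF G H, of \<phi> e "p e" e] that by (auto simp: tree_def)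
  thus ?thesis unfolding hom_number_def hom_sum_def
    by (intro sum.cong) (auto simp: tree_def)
qed

text \<open>Summing first over the image \<open>k\<close> of the leaf leaves a factor depending only
  on the image of its parent.\<close>

lemma hom_sum_Suc:
  assumes p: "\<And>v. 0 < v \<Longrightarrow> p v < v"
  shows "hom_sum H p (Suc n) c = hom_sum H p n (c(p (Suc n) :=
    (\<lambda>i. c (p (Suc n)) i * (\<Sum>k<wsize H. eweight H i k * c (Suc n) k))))"
proof -
  define r where "r = p (Suc n)"
  define q where "q = wsize H"
  have r: "r \<le> n" using p[of "Suc n"] by (simp add: r_def)
  have pn: "p e \<le> n" if "e \<in> {1..n}" for e using p[of e] that by simp
  let ?P = "{..n} \<rightarrow>\<^sub>E {..<q}"
  have inj: "inj_on (\<lambda>(k, g). g(Suc n := k)) ({..<q} \<times> ?P)"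
    using inj_combinator[of "Suc n" "{..n}" "\<lambda>_. {..<q}"] by simp
  have "hom_sum H p (Suc n) c = (\<Sum>(k, g)\<in>{..<q} \<times> ?P.
     (\<Prod>v\<le>Suc n. c v ((g(Suc n := k)) v)) *
     (\<Prod>e\<in>{1..Suc n}. eweight H ((g(Suc n := k)) (p e)) ((g(Suc n := k)) e)))"
    unfolding hom_sum_def q_def[symmetric] atMost_Suc PiE_insert_eq
    by (subst sum.reindex[OF inj]) (simp add: case_prod_unfold)
  also have "\<dots> = (\<Sum>(k, g)\<in>{..<q} \<times> ?P.
     (\<Prod>v\<le>n. c v (g v)) * (\<Prod>e\<in>{1..n}. eweight H (g (p e)) (g e)) *
     (eweight H (g r) k * c (Suc n) k))"
  proof (intro sum.cong refl, clarify)
    fix k g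
    have "(\<Prod>v\<le>Suc n. c v ((g(Suc n := k)) v)) = (\<Prod>v\<le>n. c v (g v)) * c (Suc n) k"
      by (simp add: mult.commute)
    moreover have "(\<Prod>e\<in>{1..Suc n}. eweight H ((g(Suc n := k)) (p e)) ((g(Suc n := k)) e))
        = (\<Prod>e\<in>{1..n}. eweight H ((g(Suc n := k)) (p e)) ((g(Suc n := k)) e)) * eweight H (g r) k"
      using r by (simp add: r_def)
    moreover have "(\<Prod>e\<in>{1..n}. eweight H ((g(Suc n := k)) (p e)) ((g(Suc n := k)) e))
        = (\<Prod>e\<in>{1..n}. eweight H (g (p e)) (g e))"
      using pn by (intro prod.cong) (auto, metis Suc_n_not_le_n)
    ultimately show "(\<Prod>v\<le>Suc n. c v ((g(Suc n := k)) v)) *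
       (\<Prod>e\<in>{1..Suc n}. eweight H ((g(Suc n := k)) (p e)) ((g(Suc n := k)) e)) =
       (\<Prod>v\<le>n. c v (g v)) * (\<Prod>e\<in>{1..n}. eweight H (g (p e)) (g e)) *
       (eweight H (g r) k * c (Suc n) k)"
      by (simp only: mult_ac)
  qed
  also have "\<dots> = (\<Sum>g\<in>?P. (\<Prod>v\<le>n. c v (g v)) * (\<Prod>e\<in>{1..n}. eweight H (g (p e)) (g e)) *
     (\<Sum>k<q. eweight H (g r) k * c (Suc n) k))"
    by (subst sum.cartesian_product[symmetric], subst sum.swap) (simp add: sum_distrib_left)
  also have "\<dots> = hom_sum H p n (c(r := (\<lambda>i. c r i * (\<Sum>k<q. eweight H i k * c (Suc n) k))))"
    unfolding hom_sum_def q_def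
  proof (intro sum.cong refl)
    fix g :: "nat \<Rightarrow> nat"
    have "finite {..n}" "r \<in> {..n}" using r by auto
    thus "(\<Prod>v\<le>n. c v (g v)) * (\<Prod>e\<in>{1..n}. eweight H (g (p e)) (g e)) *
        (\<Sum>k<wsize H. eweight H (g r) k * c (Suc n) k) =
      (\<Prod>v\<le>n. (c(r := \<lambda>i. c r i * (\<Sum>k<wsize H. eweight H i k * c (Suc n) k))) v (g v)) *
      (\<Prod>e\<in>{1..n}. eweight H (g (p e)) (g e))"
      by (simp add: prod.remove mult_ac)
  qed
  finally show ?thesis by (simp add: r_def q_def)
qed

definition matching_sum :: "(nat \<Rightarrow> nat) \<Rightarrow> nat \<Rightarrow> (nat \<Rightarrow> nat \<Rightarrow> 'a::field) \<Rightarrow> 'a" where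
  "matching_sum p n c = (\<Sum>M\<in>Pow {1..n}. \<Prod>v\<le>n. c v (card {e \<in> M. v \<in> {e, p e}}))"

lemma wm_tree:
  assumes p: "\<And>v. 0 < v \<Longrightarrow> p v < v"
  shows "wm a (tree p n) = matching_sum p n (\<lambda>_. moment a)"
  using wm_eq_sum_moments[of "tree p n" a] simple_tree[OF p]
  by (simp add: simple_graph_def matching_sum_def tree_def)

text \<open>Split by whether \<open>M\<close> contains the edge of the leaf: if not, the leaf has
  degree 0; if so, it has degree 1 and the degree of its parent rises by one.\<close>

lemma matching_sum_Suc:
  assumes p: "\<And>v. 0 < v \<Longrightarrow> p v < v"
  shows "matching_sum p (Suc n) c = matching_sum p n (c(p (Suc n) :=
    (\<lambda>k. c (p (Suc n)) k * c (Suc n) 0 + c (p (Suc n)) (Suc k) * c (Suc n) 1)))"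
proof -
  define r where "r = p (Suc n)"
  have r: "r \<le> n" using p[of "Suc n"] by (simp add: r_def)
  have pn: "p e \<le> n" if "e \<in> {1..n}" for e using p[of e] that by simp
  let ?m = "\<lambda>M v. card {e \<in> M. v \<in> {e, p e}}"
  let ?f = "\<lambda>M. \<Prod>v\<le>Suc n. c v (?m M v)"
  have new: "Suc n \<notin> {1..n}" by simp
  have "matching_sum p (Suc n) c = (\<Sum>M\<in>Pow {1..n} \<union> insert (Suc n) ` Pow {1..n}. ?f M)"
    unfolding matching_sum_def
    using Pow_insert[of "Suc n" "{1..n}"] by (simp add: atLeastAtMostSuc_conv)
  also have "\<dots> = (\<Sum>M\<in>Pow {1..n}. ?f M) + (\<Sum>M\<in>insert (Suc n) ` Pow {1..n}. ?f M)"
    using new by (intro sum.union_disjoint) auto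
  also have "(\<Sum>M\<in>insert (Suc n) ` Pow {1..n}. ?f M) = (\<Sum>M\<in>Pow {1..n}. ?f (insert (Suc n) M))"
  proof (subst sum.reindex)
    show "inj_on (insert (Suc n)) (Pow {1..n})"
      using new by (intro inj_onI) (metis PowD insert_ident subsetD)
  qed simp
  also have "(\<Sum>M\<in>Pow {1..n}. ?f M) + \<dots> = (\<Sum>M\<in>Pow {1..n}. ?f M + ?f (insert (Suc n) M))"
    by (simp add: sum.distrib)
  also have "\<dots> = matching_sum p n (c(r := (\<lambda>k. c r k * c (Suc n) 0 + c r (Suc k) * c (Suc n) 1)))"
    unfolding matching_sum_def
  proof (intro sum.cong refl)
    fix M assume M: "M \<in> Pow {1..n}"
    have finM: "finite M" using M finite_subset by auto
    let ?R = "\<Prod>v\<in>{..n} - {r}. c v (?m M v)"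
    have split: "(\<Prod>v\<le>n. f v) = f r * (\<Prod>v\<in>{..n} - {r}. f v)" for f :: "nat \<Rightarrow> 'a"
      using r by (intro prod.remove) auto
    have z: "{e \<in> M. Suc n \<in> {e, p e}} = {}" using M pn by fastforce
    have m1: "?m (insert (Suc n) M) (Suc n) = 1"
    proof -
      have "{e \<in> insert (Suc n) M. Suc n \<in> {e, p e}} = {Suc n}" using z by auto
      thus ?thesis by simp
    qed
    have mr: "?m (insert (Suc n) M) r = Suc (?m M r)"
    proof -
      have "{e \<in> insert (Suc n) M. r \<in> {e, p e}} = insert (Suc n) {e \<in> M. r \<in> {e, p e}}"
        by (auto simp: r_def)
      moreover have "Suc n \<notin> M" using M by auto
      ultimately show ?thesis using finM by simp
    qed
    have mv: "?m (insert (Suc n) M) v = ?m M v" if "v \<in> {..n} - {r}" for v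
      using that by (intro arg_cong[of _ _ card]) (auto simp: r_def)
    have "?f M = c r (?m M r) * ?R * c (Suc n) 0"
      unfolding prod.atMost_Suc z card.empty split by (simp only: mult_ac)
    moreover have "?f (insert (Suc n) M) = c r (Suc (?m M r)) * ?R * c (Suc n) 1"
    proof -
      have "?f (insert (Suc n) M) = (\<Prod>v\<le>n. c v (?m (insert (Suc n) M) v)) * c (Suc n) 1"
        unfolding prod.atMost_Suc m1 by (rule refl)
      also have "\<dots> = c r (Suc (?m M r)) * (\<Prod>v\<in>{..n} - {r}. c v (?m (insert (Suc n) M) v)) * c (Suc n) 1"
        unfolding split mr by (rule refl)
      also have "(\<Prod>v\<in>{..n} - {r}. c v (?m (insert (Suc n) M) v)) = ?R"
        using mv by (intro prod.cong refl) presburger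
      finally show ?thesis .
    qed
    ultimately show "?f M + ?f (insert (Suc n) M) =
        (\<Prod>v\<le>n. (c(r := \<lambda>k. c r k * c (Suc n) 0 + c r (Suc k) * c (Suc n) 1)) v (?m M v))"
      unfolding split by (simp add: algebra_simps)
  qed
  finally show ?thesis by (simp add: r_def)
qed

section \<open>Spiders\<close>

text \<open>Vertex 0 is the centre, \<open>1..d\<close> are its neighbours, and \<open>v + d\<close>
  extends the leg through \<open>v\<close>. For \<open>j \<le> d\<close> the tree on
  \<open>{..d + j}\<close> thus has \<open>j\<close> legs of length two and \<open>d - j\<close> of
  length one.\<close>

definition spider_parent :: "nat \<Rightarrow> nat \<Rightarrow> nat" where
  "spider_parent d v = (if v \<le> d then 0 else v - d)"

lemma spider_parent_less: "0 < d \<Longrightarrow> 0 < v \<Longrightarrow> spider_parent d v < v"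
  by (auto simp: spider_parent_def)

lemma max_degree_spider:
  assumes "2 \<le> d"
  shows "max_degree_le (tree (spider_parent d) n) d"
  unfolding max_degree_le_def
proof
  fix v
  have eq: "degree (tree (spider_parent d) n) v = card {e \<in> {1..n}. v \<in> {e, spider_parent d e}}"
    by (simp add: degree_def tree_def)
  show "degree (tree (spider_parent d) n) v \<le> d"
  proof (cases "v = 0")
    case True
    have "card {e \<in> {1..n}. v \<in> {e, spider_parent d e}} \<le> card {1..d}"
      using True by (intro card_mono) (auto simp: spider_parent_def split: if_splits)
    thus ?thesis using eq by simp
  next
    case False
    \<comment> \<open>Off the centre, the only possible edges are the one to the parent and the one
      to the outer vertex \<open>v + d\<close>.\<close>
    have "card {e \<in> {1..n}. v \<in> {e, spider_parent d e}} \<le> card {v, v + d}"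
      using False by (intro card_mono) (auto simp: spider_parent_def split: if_splits)
    also have "\<dots> \<le> 2" by (simp add: card_insert_if)
    finally show ?thesis using eq assms by simp
  qed
qed

text \<open>Outer vertices hang on distinct inner ones, so their successive removals do not
  interfere. Abstracting \<open>val\<close> and \<open>att\<close> serves homomorphism sums and
  matching sums alike.\<close>

lemma peel_outer_vertices:
  fixes val :: "nat \<Rightarrow> (nat \<Rightarrow> 'c) \<Rightarrow> 'b"
  assumes step: "\<And>n c. val (Suc n) c = val n (c(spider_parent d (Suc n) :=
      att (c (spider_parent d (Suc n))) (c (Suc n))))"
  assumes "j \<le> d"
  shows "val (d + j) c = val d (\<lambda>v. if v \<in> {1..j} then att (c v) (c (v + d)) else c v)"
  using assms(2)
proof (induction j arbitrary: c)
  case (Suc j)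
  have "val (d + Suc j) c = val (d + j) (c(Suc j := att (c (Suc j)) (c (Suc (d + j)))))" (is "_ = val _ ?c")
    using step[of "d + j" c] by (simp add: spider_parent_def)
  also have "\<dots> = val d (\<lambda>v. if v \<in> {1..j} then att (?c v) (?c (v + d)) else ?c v)"
    using Suc by simp
  also have "(\<lambda>v. if v \<in> {1..j} then att (?c v) (?c (v + d)) else ?c v)
      = (\<lambda>v. if v \<in> {1..Suc j} then att (c v) (c (v + d)) else c v)"
    using Suc.prems by (auto simp: fun_eq_iff add.commute)
  finally show ?case .
qed simp

lemma hom_sum_star:
  assumes "0 < d" "n \<le> d"
  shows "hom_sum H (spider_parent d) n c =
    (\<Sum>i<wsize H. c 0 i * (\<Prod>v\<in>{1..n}. \<Sum>k<wsize H. eweight H i k * c v k))"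
  using assms(2)
proof (induction n arbitrary: c)
  case 0
  have "inj_on (\<lambda>(k, g). g(0::nat := k)) ({..<wsize H} \<times> (({}::nat set) \<rightarrow>\<^sub>E {..<wsize H}))"
    using inj_combinator[of 0 "{}::nat set" "\<lambda>_. {..<wsize H}"] by simp
  hence "hom_sum H (spider_parent d) 0 c = (\<Sum>(k, g)\<in>{..<wsize H} \<times> (({}::nat set) \<rightarrow>\<^sub>E {..<wsize H}). c 0 k)"
    unfolding hom_sum_def atMost_0 PiE_insert_eq
    by (subst sum.reindex) (auto simp: case_prod_unfold)
  thus ?case by (simp add: sum.cartesian_product[symmetric])
next
  case (Suc n)
  have "spider_parent d (Suc n) = 0" using Suc.prems by (simp add: spider_parent_def)
  thus ?case
    using hom_sum_Suc[of "spider_parent d" H n c] spider_parent_less[OF assms(1)] Suc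
    by (simp add: mult_ac)
qed

text \<open>The weight of the centre is encoded by a polynomial \<open>P\<close>: removing a leaf
  with weight function \<open>y\<close> multiplies \<open>P\<close> by \<open>[:y 0, y 1:]\<close>.
  Hence the induction needs arbitrary \<open>P\<close>.\<close>

lemma matching_sum_star:
  assumes "0 < d" "n \<le> d" "\<And>k. c 0 k = moment_functional a (P * monom 1 k)"
  shows "matching_sum (spider_parent d) n c =
    moment_functional a (P * (\<Prod>v\<in>{1..n}. [:c v 0, c v 1:]))"
  using assms(2,3)
proof (induction n arbitrary: c P)
  case 0
  show ?case using 0(2)[of 0] by (simp add: matching_sum_def)
next
  case (Suc n)
  have p0: "spider_parent d (Suc n) = 0" using Suc.prems by (simp add: spider_parent_def)
  let ?l = "[:c (Suc n) 0, c (Suc n) 1:]"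
  have "c 0 k * c (Suc n) 0 + c 0 (Suc k) * c (Suc n) 1 = moment_functional a (P * ?l * monom 1 k)" for k
  proof -
    have "P * ?l * monom 1 k = smult (c (Suc n) 0) (P * monom 1 k) + smult (c (Suc n) 1) (P * monom 1 (Suc k))"
      by (simp add: monom_Suc algebra_simps)
    thus ?thesis using Suc.prems(2) by (simp add: moment_functional_simps mult_ac)
  qed
  hence "matching_sum (spider_parent d) n (c(0 :=
      (\<lambda>k. c 0 k * c (Suc n) 0 + c 0 (Suc k) * c (Suc n) 1))) =
      moment_functional a (P * ?l * (\<Prod>v\<in>{1..n}. [:c v 0, c v 1:]))"
    using Suc.prems(1) by (subst Suc.IH[where P = "P * ?l"]) auto
  moreover have "P * ?l * (\<Prod>v\<in>{1..n}. [:c v 0, c v 1:]) = P * (\<Prod>v\<in>{1..Suc n}. [:c v 0, c v 1:])"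
    by (simp only: prod.nat_ivl_Suc' le_add1 plus_1_eq_Suc) (simp only: mult_ac)
  ultimately show ?case
    using matching_sum_Suc[of "spider_parent d" n c] spider_parent_less[OF assms(1)] p0 by simp
qed

lemma prod_if_le:
  fixes x y :: "'b::comm_monoid_mult"
  assumes "j \<le> d"
  shows "(\<Prod>v\<in>{1..d}. if v \<in> {1..j} then x else y) = y ^ (d - j) * x ^ j"
proof -
  have "{1..d} = {1..j} \<union> {j+1..d}" using assms by auto
  hence "(\<Prod>v\<in>{1..d}. if v \<in> {1..j} then x else y) =
      (\<Prod>v\<in>{1..j}. if v \<in> {1..j} then x else y) * (\<Prod>v\<in>{j+1..d}. if v \<in> {1..j} then x else y)"
    by (simp only:) (rule prod.union_disjoint; auto)
  also have "(\<Prod>v\<in>{j+1..d}. if v \<in> {1..j} then x else y) = (\<Prod>v\<in>{j+1..d}. y)"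
    by (intro prod.cong) auto
  finally show ?thesis by (simp add: mult.commute)
qed

text \<open>With the centre mapped to \<open>i\<close>, a leg of length one contributes
  \<open>b i\<close> and a leg of length two contributes \<open>c i\<close>.\<close>

lemma hom_number_spider:
  fixes H :: "'a::field wgraph"
  assumes H: "is_wgraph H" and d: "0 < d" "j \<le> d"
  defines "b \<equiv> \<lambda>i. \<Sum>k<wsize H. eweight H i k * vweight H k"
  defines "c \<equiv> \<lambda>i. \<Sum>k<wsize H. eweight H i k * (vweight H k * b k)"
  shows "hom_number (tree (spider_parent d) (d + j)) H =
    (\<Sum>i<wsize H. vweight H i * (b i ^ (d - j) * c i ^ j))"
proof -
  note p = spider_parent_less[OF d(1)]
  let ?w = "\<lambda>v. if v \<in> {1..j} then \<lambda>i. vweight H i * b i else vweight H"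
  have "hom_number (tree (spider_parent d) (d + j)) H = hom_sum H (spider_parent d) (d + j) (\<lambda>_. vweight H)"
    by (rule hom_number_tree[OF p H])
  also have "\<dots> = hom_sum H (spider_parent d) d ?w"
    unfolding b_def
    by (rule peel_outer_vertices[where val = "hom_sum H (spider_parent d)" and c = "\<lambda>_. vweight H" and
        att = "\<lambda>x y i. x i * (\<Sum>k<wsize H. eweight H i k * y k)"])
      (use hom_sum_Suc[OF p] d in auto)
  also have "\<dots> = (\<Sum>i<wsize H. vweight H i * (\<Prod>v\<in>{1..d}. if v \<in> {1..j} then c i else b i))"
    unfolding hom_sum_star[OF d(1) order_refl]
    by (intro sum.cong refl arg_cong2[of _ _ _ _ "(*)"] prod.cong) (auto simp: b_def c_def)
  finally show ?thesis unfolding prod_if_le[OF d(2)] .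
qed

text \<open>A leaf has weights \<open>a\<close> and 1 in degrees 0 and 1, giving
  \<open>[:a, 1:]\<close>. An inner vertex after losing its outer neighbour has weights
  \<open>a\<^sup>2 + 1\<close> and \<open>a\<close>, giving the other factor.\<close>

lemma wm_spider:
  assumes d: "0 < d" "j \<le> d"
  shows "wm a (tree (spider_parent d) (d + j)) = moment_functional a ([:a, 1:] ^ (d - j) * [:a\<^sup>2 + 1, a:] ^ j)"
proof -
  note p = spider_parent_less[OF d(1)]
  let ?m = "\<lambda>k. moment a k * a + moment a (Suc k)"
  let ?w = "\<lambda>v. if v \<in> {1..j} then ?m else moment a"
  have "wm a (tree (spider_parent d) (d + j)) = matching_sum (spider_parent d) (d + j) (\<lambda>_. moment a)"
    by (rule wm_tree[OF p])
  also have "\<dots> = matching_sum (spider_parent d) d (\<lambda>v. if v \<in> {1..j} then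
      (\<lambda>k. moment a k * moment a 0 + moment a (Suc k) * moment a 1) else moment a)"
    by (rule peel_outer_vertices[where val = "matching_sum (spider_parent d)" and c = "\<lambda>_. moment a" and
        att = "\<lambda>x y k. x k * y 0 + x (Suc k) * y 1"])
      (use matching_sum_Suc[OF p] d in auto)
  also have "\<dots> = matching_sum (spider_parent d) d ?w"
    by (rule arg_cong[of _ _ "matching_sum (spider_parent d) d"]) (auto simp: fun_eq_iff moment_def)
  also have "\<dots> = moment_functional a (1 * (\<Prod>v\<in>{1..d}. [:?w v 0, ?w v 1:]))"
    by (rule matching_sum_star) (use d in \<open>auto simp: moment_functional_simps\<close>)
  also have "(\<Prod>v\<in>{1..d}. [:?w v 0, ?w v 1:]) = (\<Prod>v\<in>{1..d}. if v \<in> {1..j} then [:a\<^sup>2 + 1, a:] else [:a, 1:])"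
    by (intro prod.cong) (auto simp: moment_def power2_eq_square)
  finally show ?thesis unfolding prod_if_le[OF d(2)] by simp
qed

section \<open>The lower bound\<close>

lemma no_short_power_sum:
  fixes \<alpha> s t :: "nat \<Rightarrow> 'a::field"
  assumes q: "q < d"
    and eq: "\<And>j. j \<le> d \<Longrightarrow>
      (\<Sum>i<q. \<alpha> i * ((a * s i + t i) ^ (d - j) * ((a\<^sup>2 + 1) * s i + a * t i) ^ j)) =
      moment_functional a ([:a, 1:] ^ (d - j) * [:a\<^sup>2 + 1, a:] ^ j)"
  shows False
proof -
  define b where "b i = a * s i + t i" for i
  define c where "c i = (a\<^sup>2 + 1) * s i + a * t i" for i
  define ev where "ev ps i = (\<Prod>(x, y)\<leftarrow>ps. x * s i + y * t i)" for ps i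
  define pl where "pl ps = (\<Prod>(x, y)\<leftarrow>ps. [:x, y:])" for ps :: "('a \<times> 'a) list"
  \<comment> \<open>The forms of the two kinds of legs have determinant -1 and so span all linear
    forms; by linearity, their powers can be traded for arbitrary factors one at a time.\<close>
  have gen: "(\<Sum>i<q. \<alpha> i * (b i ^ m * c i ^ j * ev ps i)) =
      moment_functional a ([:a, 1:] ^ m * [:a\<^sup>2 + 1, a:] ^ j * pl ps)"
    if "m + j + length ps = d" for m j ps
    using that
  proof (induction ps arbitrary: m j)
    case Nil
    hence "m = d - j" "j \<le> d" by auto
    thus ?case using eq[of j] by (simp add: ev_def pl_def b_def c_def)
  next
    case (Cons xy ps)
    obtain x y where xy: "xy = (x, y)" by force
    \<comment> \<open>\<open>A\<close> and \<open>B\<close> are the coordinates of the form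
      \<open>(x, y)\<close> in the basis of the two leg forms.\<close>
    define A where "A = (a\<^sup>2 + 1) * y - a * x"
    define B where "B = x - a * y"
    have 1: "x * s i + y * t i = A * b i + B * c i" for i
      by (simp add: A_def B_def b_def c_def algebra_simps power2_eq_square)
    have 2: "[:x, y:] = smult A [:a, 1:] + smult B [:a\<^sup>2 + 1, a:]"
      by (simp add: A_def B_def algebra_simps power2_eq_square)
    have "(\<Sum>i<q. \<alpha> i * (b i ^ m * c i ^ j * ev (xy # ps) i)) =
        A * (\<Sum>i<q. \<alpha> i * (b i ^ Suc m * c i ^ j * ev ps i)) +
        B * (\<Sum>i<q. \<alpha> i * (b i ^ m * c i ^ Suc j * ev ps i))"
      by (simp add: ev_def xy 1 sum_distrib_left sum.distrib[symmetric] algebra_simps)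
    also have "\<dots> = A * moment_functional a ([:a, 1:] ^ Suc m * [:a\<^sup>2 + 1, a:] ^ j * pl ps) +
        B * moment_functional a ([:a, 1:] ^ m * [:a\<^sup>2 + 1, a:] ^ Suc j * pl ps)"
      using Cons.prems Cons.IH[of "Suc m" j] Cons.IH[of m "Suc j"] by simp
    also have "\<dots> = moment_functional a (smult A ([:a, 1:] ^ Suc m * [:a\<^sup>2 + 1, a:] ^ j * pl ps) +
        smult B ([:a, 1:] ^ m * [:a\<^sup>2 + 1, a:] ^ Suc j * pl ps))"
      by (simp only: moment_functional_simps)
    also have "smult A ([:a, 1:] ^ Suc m * [:a\<^sup>2 + 1, a:] ^ j * pl ps) +
        smult B ([:a, 1:] ^ m * [:a\<^sup>2 + 1, a:] ^ Suc j * pl ps) =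
        [:a, 1:] ^ m * [:a\<^sup>2 + 1, a:] ^ j * ((smult A [:a, 1:] + smult B [:a\<^sup>2 + 1, a:]) * pl ps)"
      by (simp only: power_Suc mult_smult_left mult_smult_right distrib_left distrib_right mult_ac)
    also have "\<dots> = [:a, 1:] ^ m * [:a\<^sup>2 + 1, a:] ^ j * pl (xy # ps)"
      unfolding 2[symmetric] by (simp only: pl_def xy list.map prod_list.Cons prod.case)
    finally show ?case .
  qed
  \<comment> \<open>Collecting the slopes in a set gives each a single factor, so the second
    coordinate divides the product at most once.\<close>
  define R where "R = (\<lambda>i. t i / s i) ` {i \<in> {..<q}. s i \<noteq> 0}"
  have finR: "finite R" by (simp add: R_def)
  then obtain rs where rs: "set rs = R" "distinct rs" using finite_distinct_list by blast
  have len: "length rs \<le> card {i \<in> {..<q}. s i \<noteq> 0}"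
    using rs card_image_le[of "{i \<in> {..<q}. s i \<noteq> 0}" "\<lambda>i. t i / s i"]
    by (simp add: R_def distinct_card[symmetric])
  have leq: "card {i \<in> {..<q}. s i \<noteq> 0} \<le> q"
    using card_mono[of "{..<q}" "{i \<in> {..<q}. s i \<noteq> 0}"] by fastforce
  \<comment> \<open>One factor \<open>t - r * s\<close> for each slope; a padding factor \<open>s\<close> is left over if some \<open>s i = 0\<close>.\<close>
  define ps :: "('a \<times> 'a) list" where "ps = map (\<lambda>r. (- r, 1)) rs @ replicate (d - 1 - length rs) (1, 0)"
  have lps: "length ps = d - 1" using len leq q by (simp add: ps_def)
  have ev0: "ev ps i = 0" if i: "i < q" for i
  proof (cases "s i = 0")
    case True
    have "{i \<in> {..<q}. s i \<noteq> 0} \<subset> {..<q}" using True i by auto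
    hence "card {i \<in> {..<q}. s i \<noteq> 0} < q" by (metis card_lessThan finite_lessThan psubset_card_mono)
    hence "length rs < d - 1" using len q by simp
    hence "(1, 0) \<in> set ps" by (simp add: ps_def)
    hence "1 * s i + 0 * t i \<in> set (map (\<lambda>(x, y). x * s i + y * t i) ps)"
      unfolding set_map by (rule rev_image_eqI) simp
    thus ?thesis using True by (simp only: ev_def prod_list_zero_iff) simp
  next
    case False
    hence "t i / s i \<in> set rs" using i by (auto simp: rs R_def)
    hence "(- (t i / s i), 1) \<in> set ps" by (auto simp: ps_def)
    hence "- (t i / s i) * s i + 1 * t i \<in> set (map (\<lambda>(x, y). x * s i + y * t i) ps)"
      unfolding set_map by (rule rev_image_eqI) simp
    thus ?thesis using False by (simp only: ev_def prod_list_zero_iff) simp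
  qed
  have zero: "moment_functional a ([:x, y:] * pl ps) = 0" for x y
  proof -
    have "(\<Sum>i<q. \<alpha> i * (b i ^ 0 * c i ^ 0 * ev ((x, y) # ps) i)) =
        moment_functional a ([:a, 1:] ^ 0 * [:a\<^sup>2 + 1, a:] ^ 0 * pl ((x, y) # ps))"
      using q lps by (intro gen) simp
    moreover have "ev ((x, y) # ps) i = 0" if "i < q" for i
      using ev0[OF that] by (simp add: ev_def)
    ultimately show ?thesis by (simp add: pl_def)
  qed
  define f where "f S = (\<Prod>r\<in>S. [:- r, 1:])" for S :: "'a set"
  \<comment> \<open>Setting the first coordinate to 1 turns the padding factors into 1.\<close>
  have "pl ps = (\<Prod>r\<leftarrow>rs. [:- r, 1:])"
    by (simp add: pl_def ps_def o_def one_pCons[symmetric])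
  hence plf: "pl ps = f R"
    using rs prod.distinct_set_conv_list[of rs "\<lambda>r. [:- r, 1:]"] by (simp add: f_def)
  have f0: "coeff (f S) 0 = (\<Prod>r\<in>S. - r)" for S
    by (simp add: f_def poly_0_coeff_0[symmetric] poly_prod)
  \<comment> \<open>With last factor \<open>x\<close>, the functional returns the constant term, so
    0 is a slope. With last factor 1 it then returns the linear coefficient, a product of nonzero
    numbers.\<close>
  have "coeff (f R) 0 = 0"
    using zero[of 0 1] by (simp add: plf moment_functional_def)
  hence "0 \<in> R" using finR by (simp add: f0)
  hence "f R = pCons 0 (f (R - {0}))"
    using finR by (simp add: f_def prod.remove[of R 0])
  moreover have "moment_functional a (f R) = 0"
    using zero[of 1 0] by (simp add: plf)
  ultimately have "coeff (f (R - {0})) 0 = 0" by (simp add: moment_functional_def)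
  thus False using finR by (simp add: f0)
qed

lemma no_small_wgraph:
  fixes H :: "'a::field wgraph"
  assumes d: "d \<ge> 2" and H: "is_wgraph H" "wsize H < d"
    and eq: "\<And>G :: graph. simple_graph G \<Longrightarrow> max_degree_le G d \<Longrightarrow> wm a G = hom_number G H"
  shows False
proof -
  define b where "b i = (\<Sum>k<wsize H. eweight H i k * vweight H k)" for i
  define c where "c i = (\<Sum>k<wsize H. eweight H i k * (vweight H k * b k))" for i
  \<comment> \<open>\<open>s\<close> and \<open>t\<close> invert the leg forms, so that
    \<open>b i\<close> and \<open>c i\<close> become their values at
    \<open>(s i, t i)\<close>.\<close>
  define s where "s i = c i - a * b i" for i
  define t where "t i = (a\<^sup>2 + 1) * b i - a * c i" for i
  have b: "a * s i + t i = b i" and c: "(a\<^sup>2 + 1) * s i + a * t i = c i" for i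
    by (simp_all add: s_def t_def algebra_simps power2_eq_square)
  show False
  proof (rule no_short_power_sum[OF H(2), where \<alpha> = "vweight H" and s = s and t = t and a = a])
    fix j assume j: "j \<le> d"
    let ?T = "tree (spider_parent d) (d + j)"
    have "simple_graph ?T" using d by (intro simple_tree spider_parent_less) auto
    hence "wm a ?T = hom_number ?T H" using eq max_degree_spider[OF d] by blast
    thus "(\<Sum>i<wsize H. vweight H i * ((a * s i + t i) ^ (d - j) * ((a\<^sup>2 + 1) * s i + a * t i) ^ j)) =
      moment_functional a ([:a, 1:] ^ (d - j) * [:a\<^sup>2 + 1, a:] ^ j)"
      using hom_number_spider[OF H(1) _ j] wm_spider[OF _ j, of a] d
      unfolding b c by (simp add: b_def c_def)
  qed
qed

section \<open>The exceptional case: two vertices joined by parallel edges\<close>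

definition parallel_edges :: "nat \<Rightarrow> graph" where
  "parallel_edges m = \<lparr>verts = {0, 1}, edges = {..<m}, ends = (\<lambda>_. {0, 1})\<rparr>"

lemma is_graph_parallel_edges: "is_graph (parallel_edges m)"
  by (simp add: is_graph_def parallel_edges_def)

text \<open>For \<open>a = 0\<close> only perfect matchings count, here the single edges.\<close>

lemma wm_parallel_edges: "wm 0 (parallel_edges m) = of_nat m"
proof -
  have "matchings (parallel_edges m) = insert {} ((\<lambda>e. {e}) ` {..<m})"
  proof (intro equalityI subsetI)
    fix M assume M: "M \<in> matchings (parallel_edges m)"
    show "M \<in> insert {} ((\<lambda>e. {e}) ` {..<m})"
    proof (cases "M = {}")
      case False
      then obtain e where e: "e \<in> M" by auto
      hence "M = {e}" using M by (auto simp: matchings_def parallel_edges_def disjoint_family_on_def)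
      thus ?thesis using M by (auto simp: matchings_def parallel_edges_def)
    qed simp
  qed (auto simp: matchings_def parallel_edges_def disjoint_family_on_def)
  moreover have "{} \<notin> (\<lambda>e. {e}) ` {..<m}" by auto
  ultimately show ?thesis
    by (simp add: wm_def sum.reindex) (simp add: parallel_edges_def)
qed

lemma hom_number_parallel_edges:
  assumes "is_wgraph H"
  shows "hom_number (parallel_edges m) H =
    (\<Sum>i<wsize H. \<Sum>j<wsize H. vweight H i * vweight H j * eweight H i j ^ m)"
proof -
  let ?Q = "{..<wsize H}"
  let ?f = "\<lambda>\<phi>. vweight H (\<phi> (0::nat)) * vweight H (\<phi> (1::nat)) * eweight H (\<phi> 0) (\<phi> 1) ^ m"
  have "hom_number (parallel_edges m) H = (\<Sum>\<phi>\<in>{0, 1::nat} \<rightarrow>\<^sub>E ?Q. ?f \<phi>)"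
    unfolding hom_number_def
  proof (rule sum.cong)
    fix \<phi> :: "nat \<Rightarrow> nat" assume \<phi>: "\<phi> \<in> {0, 1} \<rightarrow>\<^sub>E ?Q"
    have "edge_factor (parallel_edges m) H \<phi> e = eweight H (\<phi> 0) (\<phi> 1)" if "e < m" for e
      using edge_factor_eq[OF is_graph_parallel_edges assms, of \<phi> m e 0 1] that \<phi> by (auto simp: parallel_edges_def)
    thus "(\<Prod>u\<in>verts (parallel_edges m). vweight H (\<phi> u)) * (\<Prod>e\<in>edges (parallel_edges m). edge_factor (parallel_edges m) H \<phi> e) = ?f \<phi>"
      by (simp add: parallel_edges_def)
  qed (simp add: parallel_edges_def)
  also have "\<dots> = (\<Sum>(i, j)\<in>?Q \<times> ?Q. vweight H i * vweight H j * eweight H i j ^ m)"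
    by (rule sum.reindex_bij_witness[where j = "\<lambda>\<phi>. (\<phi> 0, \<phi> 1)" and
        i = "\<lambda>(i, j). (\<lambda>v\<in>{0, 1}. if v = 0 then i else j)"])
      (auto simp: fun_eq_iff PiE_def extensional_def Pi_def)
  finally show ?thesis by (simp add: sum.cartesian_product)
qed

text \<open>In characteristic 2 the mixed terms vanish. No edge forces \<open>y = - x\<close>; one
  edge then gives \<open>x\<^sup>2 * (p + r) = 1\<close>, while two edges make the square of
  \<open>x * (p + r)\<close> vanish.\<close>

lemma no_wgraph_of_size_two:
  fixes H :: "'a::field wgraph"
  assumes char: "CHAR('a) = 2" and H: "is_wgraph H" "wsize H = 2"
    and eq: "\<And>G :: graph. is_graph G \<Longrightarrow> max_degree_le G 2 \<Longrightarrow> wm 0 G = hom_number G H"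
  shows False
proof -
  have two: "(2::'a) = 0" using of_nat_CHAR[where ?'a = 'a] char by simp
  define x y where "x = vweight H 0" and "y = vweight H 1"
  define p q r where "p = eweight H 0 0" and "q = eweight H 0 1" and "r = eweight H 1 1"
  have sym: "eweight H 1 0 = q" using H by (simp add: is_wgraph_def q_def)
  have val: "of_nat m = x\<^sup>2 * p ^ m + 2 * x * y * q ^ m + y\<^sup>2 * r ^ m" if "m \<le> 2" for m
  proof -
    have "max_degree_le (parallel_edges m) 2"
      using that by (auto simp: max_degree_le_def degree_def parallel_edges_def)
    hence "of_nat m = hom_number (parallel_edges m) H"
      using eq[OF is_graph_parallel_edges] wm_parallel_edges[of m, where ?'a = 'a] by simp
    thus ?thesis using sym
      by (simp add: hom_number_parallel_edges[OF H(1)] H(2) numeral_2_eq_2 x_def y_def p_def q_def r_def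
          power2_eq_square algebra_simps)
  qed
  have "(x + y)\<^sup>2 = 0" using val[of 0] by (simp add: two power2_sum)
  hence y: "y = - x" by (simp add: add_eq_0_iff)
  have 1: "x\<^sup>2 * (p + r) = 1" using val[of 1] two by (simp add: y algebra_simps)
  have "(x * (p + r))\<^sup>2 = x\<^sup>2 * p\<^sup>2 + x\<^sup>2 * r\<^sup>2 + 2 * (x\<^sup>2 * p * r)"
    by (simp add: power2_eq_square algebra_simps)
  also have "\<dots> = 0" using val[of 2] two by (simp add: y)
  finally show False using 1 by auto
qed

theorem theorem4p5:
  fixes a :: "'a::field" and d :: nat
  assumes "d \<ge> 2"
  shows "(\<nexists>H :: 'a wgraph. is_wgraph H \<and> wsize H < d \<and>
            (\<forall>G :: graph. simple_graph G \<and> max_degree_le G d \<longrightarrow> wm a G = hom_number G H))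
       \<and> (infinite (UNIV :: 'a set) \<longrightarrow>
            (if a = 0 \<and> d = 2 \<and> CHAR('a) = 2
             then (\<exists>H :: 'a wgraph. is_wgraph H \<and> wsize H = 3 \<and>
                     (\<forall>G :: graph. is_graph G \<and> max_degree_le G d \<longrightarrow> wm a G = hom_number G H))
                \<and> (\<nexists>H :: 'a wgraph. is_wgraph H \<and> wsize H < 3 \<and>
                     (\<forall>G :: graph. is_graph G \<and> max_degree_le G d \<longrightarrow> wm a G = hom_number G H))
             else (\<exists>H :: 'a wgraph. is_wgraph H \<and> wsize H = d \<and>
                     (\<forall>G :: graph. is_graph G \<and> max_degree_le G d \<longrightarrow> wm a G = hom_number G H))))"
proof -
  have small: "\<nexists>H :: 'a wgraph. is_wgraph H \<and> wsize H < d \<and>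
      (\<forall>G :: graph. simple_graph G \<and> max_degree_le G d \<longrightarrow> wm a G = hom_number G H)"
    using no_small_wgraph[OF assms] by blast
  have exceptional: "(\<exists>H :: 'a wgraph. is_wgraph H \<and> wsize H = 3 \<and>
        (\<forall>G :: graph. is_graph G \<and> max_degree_le G d \<longrightarrow> wm a G = hom_number G H))
      \<and> (\<nexists>H :: 'a wgraph. is_wgraph H \<and> wsize H < 3 \<and>
        (\<forall>G :: graph. is_graph G \<and> max_degree_le G d \<longrightarrow> wm a G = hom_number G H))"
    if inf: "infinite (UNIV :: 'a set)" and exc: "a = 0" "d = 2" "CHAR('a) = 2"
  proof
    obtain H :: "'a wgraph" where H: "is_wgraph H" "wsize H = 3"
      "\<And>G :: graph. is_graph G \<Longrightarrow> max_degree_le G 3 \<Longrightarrow> wm a G = hom_number G H"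
      by (rule ex_wgraph[OF inf, of 3 a]) auto
    moreover have "max_degree_le G 3" if "max_degree_le G d" for G :: graph
      using that exc by (force simp: max_degree_le_def)
    ultimately show "\<exists>H :: 'a wgraph. is_wgraph H \<and> wsize H = 3 \<and>
        (\<forall>G :: graph. is_graph G \<and> max_degree_le G d \<longrightarrow> wm a G = hom_number G H)"
      by blast
    show "\<nexists>H :: 'a wgraph. is_wgraph H \<and> wsize H < 3 \<and>
        (\<forall>G :: graph. is_graph G \<and> max_degree_le G d \<longrightarrow> wm a G = hom_number G H)"
    proof
      assume "\<exists>H :: 'a wgraph. is_wgraph H \<and> wsize H < 3 \<and>
        (\<forall>G :: graph. is_graph G \<and> max_degree_le G d \<longrightarrow> wm a G = hom_number G H)"
      then obtain H :: "'a wgraph" where H: "is_wgraph H" "wsize H < 3"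
        "\<And>G :: graph. is_graph G \<Longrightarrow> max_degree_le G d \<Longrightarrow> wm a G = hom_number G H" by blast
      \<comment> \<open>Simple graphs are among the graphs considered, so the general lower bound
        leaves only size two.\<close>
      have "\<not> wsize H < d" using small H by (metis simple_graph_def)
      hence "wsize H = 2" using H(2) exc by simp
      thus False using no_wgraph_of_size_two[OF exc(3) H(1)] H(3) exc by blast
    qed
  qed
  have generic: "\<exists>H :: 'a wgraph. is_wgraph H \<and> wsize H = d \<and>
      (\<forall>G :: graph. is_graph G \<and> max_degree_le G d \<longrightarrow> wm a G = hom_number G H)"
    if inf: "infinite (UNIV :: 'a set)" and "\<not> (a = 0 \<and> d = 2 \<and> CHAR('a) = 2)"
    by (rule ex_wgraph[OF inf assms that(2)]) blast
  show ?thesis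
    using small exceptional generic by presburger
qed

end
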